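(* Let $\mathbf{C}$ be a category, $\mathrm{I}$ a set, and $\mathbf{G}:\mathbf{Gl}(\mathrm{I})\to\mathbf{C}$ a $\mathbf{C}$-gluing data functor of type $\mathrm{I}$. Let $L$ be an object of $\mathbf{C}$ and let $\pi_L=\{\pi_{L,a}\}_{a\in \mathrm{Ob}(\mathbf{Gl}(\mathrm{I}))}$ be a family of morphisms $\pi_{L,a}:L\to\mathbf{G}(a)$ of $\mathbf{C}$. Then $L$ is a glued-up $\mathbf{C}$-object along $\mathbf{G}$ through $\pi_L$ if and only if the following properties hold: (1) $\pi_{L,[i,j]}=\mathbf{G}(\eta_{i,[i,j]})\circ\pi_{L,i}$ for all $i,j\in\mathrm{I}$; (2) $\pi_{L,[i,j,k]}=\mathbf{G}(\eta_{[i,n],[i,j,k]})\circ\pi_{L,[i,n]}$ for all $i,j,k\in\mathrm{I}$ and $n\in\{j,k\}$; (3) $(L,(\pi_{L,i})_{i\in\mathrm{I}})$ is the limit over the (generalized) pullback diagram defined by the morphisms $$\mathbf{G}(\eta_{i,[i,j]}):\mathbf{G}(i)\to\mathbf{G}(i,j)\quad\text{and}\quad \mathbf{G}(\tau_{[i,j]}\circ\eta_{j,[j,i]}):\mathbf{G}(j)\to\mathbf{G}(i,j),\qquad i,j\in\mathrm{I};$$ that is, $\mathbf{G}(\eta_{i,[i,j]})\circ\pi_{L,i}=\mathbf{G}(\tau_{[i,j]}\circ\eta_{j,[j,i]})\circ\pi_{L,j}$ for all $i,j\in\mathrm{I}$, and for every object $L'$ of $\mathbf{C}$ and every family of morphisms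 $(\pi'_i:L'\to\mathbf{G}(i))_{i\in\mathrm{I}}$ with $\mathbf{G}(\eta_{i,[i,j]})\circ\pi'_i=\mathbf{G}(\tau_{[i,j]}\circ\eta_{j,[j,i]})\circ\pi'_j$ for all $i,j\in\mathrm{I}$, there is a unique morphism $\mu:L'\to L$ such that $\pi_{L,i}\circ\mu=\pi'_i$ for all $i\in\mathrm{I}$.
   Context: Gluing index category. For a set $\mathrm{I}$, the category $\mathbf{Gl}(\mathrm{I})$ has as objects the equivalence classes of elements of $\mathrm{I}\cup\mathrm{I}^2\cup\mathrm{I}^3$ under the equivalence relation generated by $i\sim(i,i)$, $(i,j,k)\sim(i,k,j)$ and $(i,j,j)\sim(i,j)$; the classes of $i$, $(i,j)$, $(i,j,k)$ are written $[i]$ (or simply $i$), $[i,j]$, $[i,j,k]$. There is at most one morphism between any two objects. The morphisms are the identities, the morphisms $\eta_{i,[i,j]}:i\to[i,j]$, $\tau_{[i,j]}:[j,i]\to[i,j]$, $\eta_{[i,n],[i,j,k]}:[i,n]\to[i,j,k]$ for $n\in\{j,k\}$, $\tau_{k,[i,j]}:[j,i,k]\to[i,j,k]$ (for all $i,j,k\in\mathrm{I}$), and their composites. In $\mathbf{Gl}(\mathrm{I})$, $[i,j,k]$ is the pushout of $[i,j]$ and $[i,k]$ over $i$ (along $\eta_{i,[i,j]}$ and $\eta_{i,[i,k]}$). Gluing data functor. A $\mathbf{C}$-gluing data functor of type $\mathrm{I}$ is a functor $\mathbf{G}:\mathbf{Gl}(\mathrm{I})\to\mathbf{C}$ sending,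 for all $i,j,k\in\mathrm{I}$, the pushout $[i,j,k]$ to the corresponding pushout in $\mathbf{C}$ (of $\mathbf{G}([i,j])$ and $\mathbf{G}([i,k])$ over $\mathbf{G}([i])$), the image of $\eta_{[i,n],[i,j,k]}$, $n\in\{j,k\}$, being the canonical morphism into that pushout. Write $\mathbf{G}(i)=\mathbf{G}([i])$, $\mathbf{G}(i,j)=\mathbf{G}([i,j])$, $\mathbf{G}(i,j,k)=\mathbf{G}([i,j,k])$. Glued-up object. $L$ is a glued-up $\mathbf{C}$-object along $\mathbf{G}$ through $\pi_L$ if the limit of $\mathbf{G}$ exists and $(L,\pi_L)$ is a cone over $\mathbf{G}$ isomorphic (as a cone) to $\lim\mathbf{G}$. *)

theory Defs
  imports Main
begin

section \<open>Categories, functors, cones and limits\<close>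

record ('o, 'a) cat =
  Obj :: "'o set"
  Arr :: "'a set"
  Dom :: "'a \<Rightarrow> 'o"
  Cod :: "'a \<Rightarrow> 'o"
  Ident :: "'o \<Rightarrow> 'a"
  Comp :: "'a \<Rightarrow> 'a \<Rightarrow> 'a" (infixl "\<cdot>\<index>" 70)

text \<open>As usual, \<open>g \<cdot> f\<close> is \<open>f\<close> followed by \<open>g\<close>; it is only meaningful when \<open>Dom g = Cod f\<close>.\<close>

definition Hom :: "('o, 'a) cat \<Rightarrow> 'o \<Rightarrow> 'o \<Rightarrow> 'a set" where
  "Hom C a b = {f \<in> Arr C. Dom C f = a \<and> Cod C f = b}"

locale category =
  fixes C :: "('o, 'a) cat" (structure)
  assumes Dom_in: "f \<in> Arr C \<Longrightarrow> Dom C f \<in> Obj C"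
    and Cod_in: "f \<in> Arr C \<Longrightarrow> Cod C f \<in> Obj C"
    and Ident_in: "a \<in> Obj C \<Longrightarrow> Ident C a \<in> Hom C a a"
    and Comp_in: "\<lbrakk>f \<in> Hom C a b; g \<in> Hom C b c\<rbrakk> \<Longrightarrow> g \<cdot> f \<in> Hom C a c"
    and Ident_left: "f \<in> Hom C a b \<Longrightarrow> Ident C b \<cdot> f = f"
    and Ident_right: "f \<in> Hom C a b \<Longrightarrow> f \<cdot> Ident C a = f"
    and Comp_assoc: "\<lbrakk>f \<in> Hom C a b; g \<in> Hom C b c; h \<in> Hom C c d\<rbrakk>
      \<Longrightarrow> (h \<cdot> g) \<cdot> f = h \<cdot> (g \<cdot> f)"

record ('p, 'b, 'o, 'a) func =
  omap :: "'p \<Rightarrow> 'o"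
  amap :: "'b \<Rightarrow> 'a"

locale is_functor = J: category J + C: category C
  for J :: "('p, 'b) cat" and C :: "('o, 'a) cat" and F :: "('p, 'b, 'o, 'a) func" +
  assumes omap_in: "a \<in> Obj J \<Longrightarrow> omap F a \<in> Obj C"
    and amap_in: "f \<in> Hom J a b \<Longrightarrow> amap F f \<in> Hom C (omap F a) (omap F b)"
    and amap_Ident: "a \<in> Obj J \<Longrightarrow> amap F (Ident J a) = Ident C (omap F a)"
    and amap_Comp: "\<lbrakk>f \<in> Hom J a b; g \<in> Hom J b c\<rbrakk>
      \<Longrightarrow> amap F (g \<cdot>\<^bsub>J\<^esub> f) = amap F g \<cdot>\<^bsub>C\<^esub> amap F f"

definition is_cone ::
  "('p, 'b) cat \<Rightarrow> ('o, 'a) cat \<Rightarrow> ('p, 'b, 'o, 'a) func \<Rightarrow> 'o \<Rightarrow> ('p \<Rightarrow> 'a) \<Rightarrow> bool" where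
  "is_cone J C F L p \<longleftrightarrow>
     L \<in> Obj C \<and>
     (\<forall>a\<in>Obj J. p a \<in> Hom C L (omap F a)) \<and>
     (\<forall>a\<in>Obj J. \<forall>b\<in>Obj J. \<forall>f\<in>Hom J a b. amap F f \<cdot>\<^bsub>C\<^esub> p a = p b)"

definition cone_morphism ::
  "('p, 'b) cat \<Rightarrow> ('o, 'a) cat \<Rightarrow> 'o \<Rightarrow> ('p \<Rightarrow> 'a) \<Rightarrow> 'o \<Rightarrow> ('p \<Rightarrow> 'a) \<Rightarrow> 'a \<Rightarrow> bool" where
  "cone_morphism J C L p M q m \<longleftrightarrow>
     m \<in> Hom C L M \<and> (\<forall>a\<in>Obj J. q a \<cdot>\<^bsub>C\<^esub> m = p a)"

definition is_limit ::
  "('p, 'b) cat \<Rightarrow> ('o, 'a) cat \<Rightarrow> ('p, 'b, 'o, 'a) func \<Rightarrow> 'o \<Rightarrow> ('p \<Rightarrow> 'a) \<Rightarrow> bool" where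
  "is_limit J C F L p \<longleftrightarrow>
     is_cone J C F L p \<and>
     (\<forall>L' p'. is_cone J C F L' p' \<longrightarrow> (\<exists>!m. cone_morphism J C L' p' L p m))"

definition cones_isomorphic ::
  "('p, 'b) cat \<Rightarrow> ('o, 'a) cat \<Rightarrow> 'o \<Rightarrow> ('p \<Rightarrow> 'a) \<Rightarrow> 'o \<Rightarrow> ('p \<Rightarrow> 'a) \<Rightarrow> bool" where
  "cones_isomorphic J C L p M q \<longleftrightarrow>
     (\<exists>m n. cone_morphism J C L p M q m \<and> cone_morphism J C M q L p n \<and>
            n \<cdot>\<^bsub>C\<^esub> m = Ident C L \<and> m \<cdot>\<^bsub>C\<^esub> n = Ident C M)"

text \<open>\<open>P\<close> with \<open>u : B \<rightarrow> P\<close> and \<open>v : D \<rightarrow> P\<close> is a pushout of \<open>f : A \<rightarrow> B\<close> and \<open>g : A \<rightarrow> D\<close>.\<close>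

definition is_pushout ::
  "('o, 'a) cat \<Rightarrow> 'o \<Rightarrow> 'o \<Rightarrow> 'o \<Rightarrow> 'a \<Rightarrow> 'a \<Rightarrow> 'o \<Rightarrow> 'a \<Rightarrow> 'a \<Rightarrow> bool" where
  "is_pushout C A B D f g P u v \<longleftrightarrow>
     f \<in> Hom C A B \<and> g \<in> Hom C A D \<and> u \<in> Hom C B P \<and> v \<in> Hom C D P \<and>
     u \<cdot>\<^bsub>C\<^esub> f = v \<cdot>\<^bsub>C\<^esub> g \<and>
     (\<forall>Q\<in>Obj C. \<forall>u'\<in>Hom C B Q. \<forall>v'\<in>Hom C D Q.
        u' \<cdot>\<^bsub>C\<^esub> f = v' \<cdot>\<^bsub>C\<^esub> g \<longrightarrow>
        (\<exists>!m. m \<in> Hom C P Q \<and> m \<cdot>\<^bsub>C\<^esub> u = u' \<and> m \<cdot>\<^bsub>C\<^esub> v = v'))"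

text \<open>\<open>(L, (p i)\<^sub>i)\<close> is the limit of the diagram consisting of the pairs
  \<open>f i j : X i \<rightarrow> Y i j\<close>, \<open>g i j : X j \<rightarrow> Y i j\<close> for \<open>i, j \<in> I\<close>. The legs to the \<open>Y i j\<close> are
  determined by the \<open>p i\<close> and are omitted.\<close>

definition is_generalized_pullback ::
  "('o, 'a) cat \<Rightarrow> 'i set \<Rightarrow> ('i \<Rightarrow> 'o) \<Rightarrow> ('i \<Rightarrow> 'i \<Rightarrow> 'a) \<Rightarrow> ('i \<Rightarrow> 'i \<Rightarrow> 'a)
     \<Rightarrow> 'o \<Rightarrow> ('i \<Rightarrow> 'a) \<Rightarrow> bool" where
  "is_generalized_pullback C I X f g L p \<longleftrightarrow>
     L \<in> Obj C \<and>
     (\<forall>i\<in>I. p i \<in> Hom C L (X i)) \<and>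
     (\<forall>i\<in>I. \<forall>j\<in>I. f i j \<cdot>\<^bsub>C\<^esub> p i = g i j \<cdot>\<^bsub>C\<^esub> p j) \<and>
     (\<forall>L'\<in>Obj C. \<forall>p'.
        (\<forall>i\<in>I. p' i \<in> Hom C L' (X i)) \<and>
        (\<forall>i\<in>I. \<forall>j\<in>I. f i j \<cdot>\<^bsub>C\<^esub> p' i = g i j \<cdot>\<^bsub>C\<^esub> p' j) \<longrightarrow>
        (\<exists>!m. m \<in> Hom C L' L \<and> (\<forall>i\<in>I. p i \<cdot>\<^bsub>C\<^esub> m = p' i)))"

section \<open>The gluing index category\<close>

datatype 'i gl_word = W1 'i | W2 'i 'i | W3 'i 'i 'i

text \<open>The disjoint union of \<open>I\<close>, \<open>I\<^sup>2\<close> and \<open>I\<^sup>3\<close>, and the equivalence relation on it generated by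
  \<open>i \<sim> (i,i)\<close>, \<open>(i,j,k) \<sim> (i,k,j)\<close> and \<open>(i,j,j) \<sim> (i,j)\<close>.\<close>

definition gl_words :: "'i set \<Rightarrow> 'i gl_word set" where
  "gl_words I = {W1 i |i. i \<in> I} \<union> {W2 i j |i j. i \<in> I \<and> j \<in> I}
     \<union> {W3 i j k |i j k. i \<in> I \<and> j \<in> I \<and> k \<in> I}"

inductive_set gl_rel :: "'i set \<Rightarrow> ('i gl_word \<times> 'i gl_word) set" for I :: "'i set" where
  diag: "i \<in> I \<Longrightarrow> (W1 i, W2 i i) \<in> gl_rel I"
| swap: "\<lbrakk>i \<in> I; j \<in> I; k \<in> I\<rbrakk> \<Longrightarrow> (W3 i j k, W3 i k j) \<in> gl_rel I"
| contract: "\<lbrakk>i \<in> I; j \<in> I\<rbrakk> \<Longrightarrow> (W3 i j j, W2 i j) \<in> gl_rel I"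
| refl: "w \<in> gl_words I \<Longrightarrow> (w, w) \<in> gl_rel I"
| sym: "(v, w) \<in> gl_rel I \<Longrightarrow> (w, v) \<in> gl_rel I"
| trans: "\<lbrakk>(u, v) \<in> gl_rel I; (v, w) \<in> gl_rel I\<rbrakk> \<Longrightarrow> (u, w) \<in> gl_rel I"

definition gl1 :: "'i set \<Rightarrow> 'i \<Rightarrow> 'i gl_word set" where
  "gl1 I i = gl_rel I `` {W1 i}"

definition gl2 :: "'i set \<Rightarrow> 'i \<Rightarrow> 'i \<Rightarrow> 'i gl_word set" where
  "gl2 I i j = gl_rel I `` {W2 i j}"

definition gl3 :: "'i set \<Rightarrow> 'i \<Rightarrow> 'i \<Rightarrow> 'i \<Rightarrow> 'i gl_word set" where
  "gl3 I i j k = gl_rel I `` {W3 i j k}"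

definition gl_obj :: "'i set \<Rightarrow> 'i gl_word set set" where
  "gl_obj I = gl_words I // gl_rel I"

text \<open>Since there is at most one morphism between two objects, a morphism is represented by the
  pair of its domain and codomain; \<open>gl_arr I\<close> is generated from the identities and the
  morphisms \<open>\<eta>\<close> and \<open>\<tau>\<close> by composition.\<close>

type_synonym 'i gl_arrow = "'i gl_word set \<times> 'i gl_word set"

definition eta1 :: "'i set \<Rightarrow> 'i \<Rightarrow> 'i \<Rightarrow> 'i gl_arrow"  \<comment> \<open>\<open>\<eta> : i \<rightarrow> [i,j]\<close>\<close> where
  "eta1 I i j = (gl1 I i, gl2 I i j)"

definition tau2 :: "'i set \<Rightarrow> 'i \<Rightarrow> 'i \<Rightarrow> 'i gl_arrow"  \<comment> \<open>\<open>\<tau> : [j,i] \<rightarrow> [i,j]\<close>\<close> where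
  "tau2 I i j = (gl2 I j i, gl2 I i j)"

definition eta2 :: "'i set \<Rightarrow> 'i \<Rightarrow> 'i \<Rightarrow> 'i \<Rightarrow> 'i \<Rightarrow> 'i gl_arrow"
    \<comment> \<open>\<open>\<eta> : [i,n] \<rightarrow> [i,j,k]\<close> for \<open>n \<in> {j,k}\<close>\<close> where
  "eta2 I n i j k = (gl2 I i n, gl3 I i j k)"

definition tau3 :: "'i set \<Rightarrow> 'i \<Rightarrow> 'i \<Rightarrow> 'i \<Rightarrow> 'i gl_arrow"
    \<comment> \<open>\<open>\<tau> : [j,i,k] \<rightarrow> [i,j,k]\<close>\<close> where
  "tau3 I k i j = (gl3 I j i k, gl3 I i j k)"

inductive_set gl_arr :: "'i set \<Rightarrow> 'i gl_arrow set" for I :: "'i set" where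
  ident: "a \<in> gl_obj I \<Longrightarrow> (a, a) \<in> gl_arr I"
| eta1: "\<lbrakk>i \<in> I; j \<in> I\<rbrakk> \<Longrightarrow> eta1 I i j \<in> gl_arr I"
| tau2: "\<lbrakk>i \<in> I; j \<in> I\<rbrakk> \<Longrightarrow> tau2 I i j \<in> gl_arr I"
| eta2: "\<lbrakk>i \<in> I; j \<in> I; k \<in> I; n \<in> {j, k}\<rbrakk> \<Longrightarrow> eta2 I n i j k \<in> gl_arr I"
| tau3: "\<lbrakk>i \<in> I; j \<in> I; k \<in> I\<rbrakk> \<Longrightarrow> tau3 I k i j \<in> gl_arr I"
| comp: "\<lbrakk>(a, b) \<in> gl_arr I; (b, c) \<in> gl_arr I\<rbrakk> \<Longrightarrow> (a, c) \<in> gl_arr I"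

definition Gl :: "'i set \<Rightarrow> ('i gl_word set, 'i gl_arrow) cat" where
  "Gl I = \<lparr>Obj = gl_obj I, Arr = gl_arr I, Dom = fst, Cod = snd,
           Ident = (\<lambda>a. (a, a)), Comp = (\<lambda>g f. (fst f, snd g))\<rparr>"

lemma gl_simps [simp]:
  "Obj (Gl I) = gl_obj I" "Arr (Gl I) = gl_arr I" "Dom (Gl I) = fst" "Cod (Gl I) = snd"
  "Ident (Gl I) a = (a, a)" "g \<cdot>\<^bsub>Gl I\<^esub> f = (fst f, snd g)"
  by (simp_all add: Gl_def)

lemma gl_rel_words: "(v, w) \<in> gl_rel I \<Longrightarrow> v \<in> gl_words I \<and> w \<in> gl_words I"
  by (induction rule: gl_rel.induct) (auto simp: gl_words_def)

lemma equiv_gl_rel: "equiv (gl_words I) (gl_rel I)"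
  by (rule equivI)
    (auto simp: refl_on_def sym_def trans_def dest: gl_rel_words intro: gl_rel.intros)

lemma gl_in_obj:
  "i \<in> I \<Longrightarrow> gl1 I i \<in> gl_obj I"
  "\<lbrakk>i \<in> I; j \<in> I\<rbrakk> \<Longrightarrow> gl2 I i j \<in> gl_obj I"
  "\<lbrakk>i \<in> I; j \<in> I; k \<in> I\<rbrakk> \<Longrightarrow> gl3 I i j k \<in> gl_obj I"
  by (auto simp: gl1_def gl2_def gl3_def gl_obj_def gl_words_def intro!: quotientI)

lemma gl_identifications:
  "i \<in> I \<Longrightarrow> gl2 I i i = gl1 I i"
  "\<lbrakk>i \<in> I; j \<in> I\<rbrakk> \<Longrightarrow> gl3 I i j j = gl2 I i j"
  "\<lbrakk>i \<in> I; j \<in> I; k \<in> I\<rbrakk> \<Longrightarrow> gl3 I i j k = gl3 I i k j"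
  unfolding gl1_def gl2_def gl3_def
  by (rule equiv_class_eq[OF equiv_gl_rel], blast intro: gl_rel.intros)+

lemma gl_obj_gl3:
  assumes "a \<in> gl_obj I"
  obtains i j k where "i \<in> I" "j \<in> I" "k \<in> I" "a = gl3 I i j k"
proof -
  obtain w where w: "w \<in> gl_words I" "a = gl_rel I `` {w}"
    using assms by (auto simp: gl_obj_def elim: quotientE)
  then consider i where "i \<in> I" "a = gl1 I i" | i j where "i \<in> I" "j \<in> I" "a = gl2 I i j"
    | i j k where "i \<in> I" "j \<in> I" "k \<in> I" "a = gl3 I i j k"
    unfolding gl_words_def gl1_def gl2_def gl3_def by blast
  then show thesis
    by cases (metis that gl_identifications)+
qed

lemma gl_arr_obj: "f \<in> gl_arr I \<Longrightarrow> fst f \<in> gl_obj I \<and> snd f \<in> gl_obj I"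
  by (induction rule: gl_arr.induct)
    (auto simp: eta1_def tau2_def eta2_def tau3_def intro: gl_in_obj)

lemma category_Gl: "category (Gl I)"
  by unfold_locales
    (auto simp: Hom_def intro: gl_arr.intros dest: gl_arr_obj)

text \<open>A morphism \<open>a \<rightarrow> b\<close> of \<open>Gl I\<close> can only exist if the indices occurring in \<open>a\<close> occur in \<open>b\<close>;
  conversely such a morphism exists, whence \<open>[i,j,k]\<close> is a pushout in \<open>Gl I\<close>.\<close>

lemma gl_rel_set: "(v, w) \<in> gl_rel I \<Longrightarrow> set_gl_word v = set_gl_word w"
  by (induction rule: gl_rel.induct) auto

lemma gl_self:
  "i \<in> I \<Longrightarrow> W1 i \<in> gl1 I i"
  "\<lbrakk>i \<in> I; j \<in> I\<rbrakk> \<Longrightarrow> W2 i j \<in> gl2 I i j"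
  "\<lbrakk>i \<in> I; j \<in> I; k \<in> I\<rbrakk> \<Longrightarrow> W3 i j k \<in> gl3 I i j k"
  by (auto simp: gl1_def gl2_def gl3_def gl_words_def intro!: gl_rel.refl)

lemma gl_obj_nonempty: "a \<in> gl_obj I \<Longrightarrow> \<exists>w. w \<in> a"
  by (metis gl_obj_gl3 gl_self(3))

lemma gl_arr_set:
  "f \<in> gl_arr I \<Longrightarrow> v \<in> fst f \<Longrightarrow> w \<in> snd f \<Longrightarrow> set_gl_word v \<subseteq> set_gl_word w"
proof (induction arbitrary: v w rule: gl_arr.induct)
  case (ident a)
  then obtain x where "a = gl_rel I `` {x}" by (auto simp: gl_obj_def elim: quotientE)
  with ident show ?case by (auto dest!: gl_rel_set)
next
  case (comp a b c)
  then obtain x where "x \<in> b" by (metis gl_arr_obj gl_obj_nonempty snd_conv)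
  with comp show ?case by fastforce
qed (auto simp: eta1_def tau2_def eta2_def tau3_def gl1_def gl2_def gl3_def dest!: gl_rel_set[symmetric])

lemma gl_arr_gl3:
  assumes abc: "a \<in> I" "b \<in> I" "c \<in> I" and ijk: "i \<in> {a, b, c}" "j \<in> {a, b, c}" "k \<in> {a, b, c}"
  shows "(gl3 I i j k, gl3 I a b c) \<in> gl_arr I"
proof -
  let ?le = "\<lambda>x y. (x, y) \<in> gl_arr I"
  have tr: "?le x z" if "?le x y" "?le y z" for x y z
    using that by (rule gl_arr.comp)
  have sw: "gl3 I x y z = gl3 I x z y" if "x \<in> I" "y \<in> I" "z \<in> I" for x y z
    using that by (rule gl_identifications)
  have t: "?le (gl3 I y x z) (gl3 I x y z)" if "x \<in> I" "y \<in> I" "z \<in> I" for x y z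
    using gl_arr.tau3[OF that] by (simp add: tau3_def)
  have e: "?le (gl2 I x y) (gl3 I x y z)" if "x \<in> I" "y \<in> I" "z \<in> I" for x y z
    using gl_arr.eta2[of x I y z y] that by (simp add: eta2_def)
  have o: "?le (gl1 I x) (gl2 I x y)" if "x \<in> I" "y \<in> I" for x y
    using gl_arr.eta1[OF that] by (simp add: eta1_def)
  have perm: "?le (gl3 I x y z) u" if "?le (gl3 I x' y' z') u"
    "x \<in> I" "y \<in> I" "z \<in> I"
    "(x', y', z') \<in> {(x,y,z), (x,z,y), (y,x,z), (y,z,x), (z,x,y), (z,y,x)}" for x y z x' y' z' u
    using that by (auto) (metis sw t tr)+
  have perm': "?le u (gl3 I x y z)" if "?le u (gl3 I x' y' z')"
    "x \<in> I" "y \<in> I" "z \<in> I"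
    "(x', y', z') \<in> {(x,y,z), (x,z,y), (y,x,z), (y,z,x), (z,x,y), (z,y,x)}" for x y z x' y' z' u
    using that by (auto) (metis sw t tr)+
  have three: "?le (gl3 I x y z) (gl3 I x y z)" if "x \<in> I" "y \<in> I" "z \<in> I" for x y z
    using that by (intro gl_arr.ident gl_in_obj)
  have two: "?le (gl3 I x y y) (gl3 I x y z)" if "x \<in> I" "y \<in> I" "z \<in> I" for x y z
    using e[OF that] that by (simp add: gl_identifications)
  have one: "?le (gl3 I x x x) (gl3 I x y z)" if "x \<in> I" "y \<in> I" "z \<in> I" for x y z
    using tr[OF o e] that by (simp add: gl_identifications)
  have two': "?le (gl3 I x y y) u" if "?le (gl3 I y x x) u" "x \<in> I" "y \<in> I" for x y u
    using gl_arr.tau2[of y I x] that by (auto simp: tau2_def gl_identifications intro: tr)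
  have two_all: "?le (gl3 I x y y) (gl3 I a b c)" if "x \<in> {a, b, c}" "y \<in> {a, b, c}" for x y
  proof -
    have "x \<in> I" "y \<in> I" using that abc by auto
    from that consider "x = y" | z where "z \<in> I"
      "(x, y, z) \<in> {(a,b,c), (a,c,b), (b,a,c), (b,c,a), (c,a,b), (c,b,a)}"
      using abc by blast
    then show ?thesis
    proof cases
      case 1
      from that(1) obtain y' z' where "y' \<in> I" "z' \<in> I"
        "(x, y', z') \<in> {(a,b,c), (b,a,c), (c,a,b)}" using abc by blast
      then show ?thesis
        using perm'[OF one[OF \<open>x \<in> I\<close>, of y' z'] abc] 1 by auto
    next
      case 2
      then show ?thesis using perm'[OF two[OF \<open>x \<in> I\<close> \<open>y \<in> I\<close>, of z] abc] by auto
    qed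
  qed
  have ijkI: "i \<in> I" "j \<in> I" "k \<in> I" using abc ijk by auto
  from ijk consider "j = k" | "i = k" | "i = j"
    | "(i, j, k) \<in> {(a,b,c), (a,c,b), (b,a,c), (b,c,a), (c,a,b), (c,b,a)}"
    by blast
  then show ?thesis
  proof cases
    case 1 then show ?thesis using two_all ijk by blast
  next
    case 2 then show ?thesis using perm[OF two_all[OF ijk(2,1)] ijkI] by blast
  next
    case 3 then show ?thesis using perm[OF two_all[OF ijk(3,1)] ijkI] by blast
  next
    case 4 then show ?thesis using perm'[OF three[OF ijkI] abc] by blast
  qed
qed

lemma gl3_pushout:
  assumes "i \<in> I" "j \<in> I" "k \<in> I"
  shows "is_pushout (Gl I) (gl1 I i) (gl2 I i j) (gl2 I i k) (eta1 I i j) (eta1 I i k)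
    (gl3 I i j k) (eta2 I j i j k) (eta2 I k i j k)"
proof -
  have "(gl3 I i j k, Q) \<in> gl_arr I"
    if Q: "Q \<in> gl_obj I" "(gl2 I i j, Q) \<in> gl_arr I" "(gl2 I i k, Q) \<in> gl_arr I" for Q
  proof -
    obtain a b c where abc: "a \<in> I" "b \<in> I" "c \<in> I" "Q = gl3 I a b c"
      using Q(1) by (rule gl_obj_gl3)
    have "{i, j} \<subseteq> {a, b, c}" "{i, k} \<subseteq> {a, b, c}"
      using gl_arr_set[OF Q(2), of "W2 i j" "W3 a b c"] gl_arr_set[OF Q(3), of "W2 i k" "W3 a b c"]
      by (simp_all add: assms abc gl_self)
    then show ?thesis using gl_arr_gl3[OF abc(1-3)] abc(4) by auto
  qed
  moreover have "eta1 I i j \<in> gl_arr I" "eta1 I i k \<in> gl_arr I"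
    "eta2 I j i j k \<in> gl_arr I" "eta2 I k i j k \<in> gl_arr I"
    using assms by (auto intro: gl_arr.intros)
  ultimately show ?thesis
    by (auto simp: is_pushout_def Hom_def eta1_def eta2_def)
qed

section \<open>Gluing data functors and glued-up objects\<close>

locale gluing_data_functor = is_functor "Gl I" C G
  for C :: "('o, 'a) cat" and I :: "'i set"
    and G :: "('i gl_word set, 'i gl_arrow, 'o, 'a) func" +
  assumes pushout: "\<lbrakk>i \<in> I; j \<in> I; k \<in> I\<rbrakk> \<Longrightarrow>
    is_pushout C
      (omap G (gl1 I i)) (omap G (gl2 I i j)) (omap G (gl2 I i k))
      (amap G (eta1 I i j)) (amap G (eta1 I i k))
      (omap G (gl3 I i j k))
      (amap G (eta2 I j i j k)) (amap G (eta2 I k i j k))"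

definition glued_up ::
  "('o, 'a) cat \<Rightarrow> 'i set \<Rightarrow> ('i gl_word set, 'i gl_arrow, 'o, 'a) func
     \<Rightarrow> 'o \<Rightarrow> ('i gl_word set \<Rightarrow> 'a) \<Rightarrow> bool" where
  "glued_up C I G L p \<longleftrightarrow>
     is_cone (Gl I) C G L p \<and>
     (\<exists>M q. is_limit (Gl I) C G M q \<and> cones_isomorphic (Gl I) C L p M q)"

end

theory Submission
  imports Defs
begin

text \<open>
  Every object \<open>a\<close> of \<open>Gl I\<close> receives an arrow from some singleton \<open>[i]\<close>, and a cone over \<open>G\<close> is
  therefore determined by its legs at the singletons, the leg at \<open>a\<close> being the composite of the leg
  at \<open>[i]\<close> with the image of \<open>[i] \<rightarrow> a\<close>. The point is that a family of legs at the singletons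
  extends to a cone as soon as it agrees on the objects \<open>[i,j]\<close>: if both \<open>[i]\<close> and \<open>[j]\<close> map to \<open>a\<close>,
  then so does \<open>[i,j]\<close>, since \<open>Gl I\<close> has an arrow whenever it has an inclusion of the occurring
  indices, and since \<open>Gl I\<close> is thin the arrows \<open>[i] \<rightarrow> a\<close> and \<open>[j] \<rightarrow> a\<close> factor
  through \<open>[i,j] \<rightarrow> a\<close>; so \<open>i\<close> and \<open>j\<close> yield the same leg at \<open>a\<close> (lemma \<open>leg_independent\<close>).

  Cones over \<open>G\<close> are thus the same as matching families at the singletons (lemmas
  \<open>cone_matching\<close> and \<open>matching_extends\<close>), and morphisms of cones may be tested there (lemma
  \<open>cone_morphism_on_singletons\<close>). Hence a cone over \<open>G\<close> is a limit exactly if its restriction is a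
  generalized pullback. Two remarks complete the argument: a cone isomorphic to a
  limit cone is itself one, and conditions (1) and (2) say that \<open>\<pi>\<close> coincides with the
  cone extending its own legs at the singletons.
\<close>

section \<open>Limits are invariant under isomorphism of cones\<close>

lemma cone_morphism_comp:
  assumes "category C" and q: "\<forall>a\<in>Obj J. r a \<in> Hom C N (omap F a)"
    and m: "cone_morphism J C L p M q m" and n: "cone_morphism J C M q N r n"
  shows "cone_morphism J C L p N r (n \<cdot>\<^bsub>C\<^esub> m)"
proof -
  interpret category C by fact
  have m': "m \<in> Hom C L M" and n': "n \<in> Hom C M N"
    using m n by (auto simp: cone_morphism_def)
  have "r a \<cdot>\<^bsub>C\<^esub> (n \<cdot>\<^bsub>C\<^esub> m) = p a" if "a \<in> Obj J" for a
    using Comp_assoc[OF m' n'] m n q that by (fastforce simp: cone_morphism_def)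
  then show ?thesis using Comp_in[OF m' n'] by (simp add: cone_morphism_def)
qed

lemma limit_transport:
  assumes "category C" and cone: "is_cone J C F L p"
    and lim: "is_limit J C F M q" and iso: "cones_isomorphic J C L p M q"
  shows "is_limit J C F L p"
proof -
  interpret category C by fact
  obtain m n where m: "cone_morphism J C L p M q m" and n: "cone_morphism J C M q L p n"
    and nm: "n \<cdot>\<^bsub>C\<^esub> m = Ident C L"
    using iso by (auto simp: cones_isomorphic_def)
  have p: "\<forall>a\<in>Obj J. p a \<in> Hom C L (omap F a)" and q: "\<forall>a\<in>Obj J. q a \<in> Hom C M (omap F a)"
    using cone lim by (auto simp: is_cone_def is_limit_def)
  have "\<exists>!h. cone_morphism J C L' p' L p h" if L': "is_cone J C F L' p'" for L' p'
  proof (rule ex_ex1I)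
    obtain h where "cone_morphism J C L' p' M q h"
      using lim L' unfolding is_limit_def by blast
    then show "\<exists>h. cone_morphism J C L' p' L p h"
      using cone_morphism_comp[OF \<open>category C\<close> p _ n] by blast
  next
    fix h k
    assume h: "cone_morphism J C L' p' L p h" and k: "cone_morphism J C L' p' L p k"
    \<comment> \<open>Both become the mediating morphism into \<open>M\<close> after \<open>m\<close>, which is split mono.\<close>
    have "m \<cdot>\<^bsub>C\<^esub> h = m \<cdot>\<^bsub>C\<^esub> k"
      using lim L' cone_morphism_comp[OF \<open>category C\<close> q h m]
        cone_morphism_comp[OF \<open>category C\<close> q k m]
      by (auto simp: is_limit_def)
    then have "(n \<cdot>\<^bsub>C\<^esub> m) \<cdot>\<^bsub>C\<^esub> h = (n \<cdot>\<^bsub>C\<^esub> m) \<cdot>\<^bsub>C\<^esub> k"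
      using h k m n Comp_assoc unfolding cone_morphism_def by metis
    then show "h = k"
      using h k Ident_left unfolding nm cone_morphism_def by metis
  qed
  then show ?thesis using cone by (simp add: is_limit_def)
qed

lemma cones_isomorphic_refl:
  assumes "category C" "is_cone J C F L p"
  shows "cones_isomorphic J C L p L p"
proof -
  interpret category C by fact
  have "L \<in> Obj C" "\<forall>a\<in>Obj J. p a \<in> Hom C L (omap F a)"
    using assms(2) by (auto simp: is_cone_def)
  then have "cone_morphism J C L p L p (Ident C L)"
    and "Ident C L \<cdot>\<^bsub>C\<^esub> Ident C L = Ident C L"
    unfolding cone_morphism_def by (metis Ident_in Ident_right)+
  then show ?thesis by (auto simp: cones_isomorphic_def)
qed

lemma glued_up_iff_limit:
  assumes "category C"
  shows "glued_up C I G L p \<longleftrightarrow> is_limit (Gl I) C G L p"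
proof
  assume "glued_up C I G L p"
  then show "is_limit (Gl I) C G L p"
    unfolding glued_up_def using limit_transport[OF assms] by blast
next
  assume lim: "is_limit (Gl I) C G L p"
  then have "is_cone (Gl I) C G L p" by (simp add: is_limit_def)
  then show "glued_up C I G L p"
    unfolding glued_up_def using lim cones_isomorphic_refl[OF assms] by blast
qed

section \<open>Singletons in the gluing index category\<close>

lemma singleton_below:
  assumes "a \<in> gl_obj I"
  obtains i where "i \<in> I" "(gl1 I i, a) \<in> gl_arr I"
proof -
  obtain i j k where ijk: "i \<in> I" "j \<in> I" "k \<in> I" "a = gl3 I i j k"
    using assms by (rule gl_obj_gl3)
  then have "(gl3 I i i i, a) \<in> gl_arr I" by (auto intro: gl_arr_gl3)
  then show thesis using that ijk(1) by (simp add: gl_identifications)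
qed

text \<open>Both \<open>i\<close> and \<open>j\<close> occur among the indices of \<open>a\<close>, and \<open>Gl I\<close> has an arrow for every inclusion
  between the occurring indices.\<close>

lemma pair_below:
  assumes "i \<in> I" "j \<in> I" and i: "(gl1 I i, a) \<in> gl_arr I" and j: "(gl1 I j, a) \<in> gl_arr I"
  shows "(gl2 I i j, a) \<in> gl_arr I"
proof -
  have "a \<in> gl_obj I" using gl_arr_obj[OF i] by simp
  then obtain x y z where a: "x \<in> I" "y \<in> I" "z \<in> I" "a = gl3 I x y z"
    by (rule gl_obj_gl3)
  have "i \<in> {x, y, z}" "j \<in> {x, y, z}"
    using gl_arr_set[OF i, of "W1 i" "W3 x y z"] gl_arr_set[OF j, of "W1 j" "W3 x y z"]
    by (simp_all add: assms(1,2) a gl_self)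
  then have "(gl3 I i j j, a) \<in> gl_arr I" using gl_arr_gl3 a by metis
  then show ?thesis using assms(1,2) by (simp add: gl_identifications)
qed

lemma singleton_to_pair:
  assumes "i \<in> I" "j \<in> I"
  shows "(gl1 I i, gl2 I i j) \<in> gl_arr I" and "(gl1 I j, gl2 I i j) \<in> gl_arr I"
proof -
  show "(gl1 I i, gl2 I i j) \<in> gl_arr I"
    using gl_arr.eta1[OF assms] by (simp add: eta1_def)
  have "(gl1 I j, gl2 I j i) \<in> gl_arr I" "(gl2 I j i, gl2 I i j) \<in> gl_arr I"
    using gl_arr.eta1[OF assms(2,1)] gl_arr.tau2[OF assms] by (simp_all add: eta1_def tau2_def)
  then show "(gl1 I j, gl2 I i j) \<in> gl_arr I" by (rule gl_arr.comp)
qed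

lemma tau_eta: "tau2 I i j \<cdot>\<^bsub>Gl I\<^esub> eta1 I j i = (gl1 I j, gl2 I i j)"
  by (simp add: tau2_def eta1_def)

section \<open>Cones as matching families at the singletons\<close>

text \<open>Families over the generalized pullback diagram; since \<open>Gl I\<close> is thin, \<open>\<tau> \<circ> \<eta> : [j] \<rightarrow> [i,j]\<close> is
  written as the pair of its end points.\<close>

definition matching_family ::
  "('o, 'a) cat \<Rightarrow> 'i set \<Rightarrow> ('i gl_word set, 'i gl_arrow, 'o, 'a) func \<Rightarrow> 'o \<Rightarrow> ('i \<Rightarrow> 'a) \<Rightarrow> bool"
where
  "matching_family C I G L x \<longleftrightarrow>
     (\<forall>i\<in>I. x i \<in> Hom C L (omap G (gl1 I i))) \<and>
     (\<forall>i\<in>I. \<forall>j\<in>I. amap G (gl1 I i, gl2 I i j) \<cdot>\<^bsub>C\<^esub> x i = amap G (gl1 I j, gl2 I i j) \<cdot>\<^bsub>C\<^esub> x j)"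

lemma generalized_pullback_iff_matching:
  "is_generalized_pullback C I (\<lambda>i. omap G (gl1 I i)) (\<lambda>i j. amap G (eta1 I i j))
      (\<lambda>i j. amap G (tau2 I i j \<cdot>\<^bsub>Gl I\<^esub> eta1 I j i)) L x \<longleftrightarrow>
    L \<in> Obj C \<and> matching_family C I G L x \<and>
    (\<forall>L'\<in>Obj C. \<forall>x'. matching_family C I G L' x' \<longrightarrow>
      (\<exists>!m. m \<in> Hom C L' L \<and> (\<forall>i\<in>I. x i \<cdot>\<^bsub>C\<^esub> m = x' i)))"
  unfolding is_generalized_pullback_def matching_family_def tau_eta
  by (simp add: eta1_def conj_assoc)

locale gl_diagram = is_functor "Gl I" C G
  for C :: "('o, 'a) cat" and I :: "'i set"
    and G :: "('i gl_word set, 'i gl_arrow, 'o, 'a) func"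
begin

lemma amap_pair:
  "(a, b) \<in> gl_arr I \<Longrightarrow> amap G (a, b) \<in> Hom C (omap G a) (omap G b)"
  by (rule amap_in) (simp add: Hom_def)

lemma amap_trans:
  assumes "(a, b) \<in> gl_arr I" "(b, c) \<in> gl_arr I" "x \<in> Hom C L (omap G a)"
  shows "amap G (b, c) \<cdot>\<^bsub>C\<^esub> (amap G (a, b) \<cdot>\<^bsub>C\<^esub> x) = amap G (a, c) \<cdot>\<^bsub>C\<^esub> x"
proof -
  have "amap G (a, c) = amap G (b, c) \<cdot>\<^bsub>C\<^esub> amap G (a, b)"
    using amap_Comp[of "(a, b)" a b "(b, c)" c] assms(1,2) by (simp add: Hom_def)
  then show ?thesis
    using C.Comp_assoc[OF assms(3) amap_pair amap_pair] assms(1,2) by simp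
qed

lemma amap_self:
  assumes "a \<in> gl_obj I" "x \<in> Hom C L (omap G a)"
  shows "amap G (a, a) \<cdot>\<^bsub>C\<^esub> x = x"
  using amap_Ident[of a] assms by (simp add: C.Ident_left)

lemma cone_natural:
  assumes "is_cone (Gl I) C G L p" "(a, b) \<in> gl_arr I"
  shows "amap G (a, b) \<cdot>\<^bsub>C\<^esub> p a = p b"
  using assms gl_arr_obj[OF assms(2)] by (auto simp: is_cone_def Hom_def)

lemma cone_matching:
  assumes "is_cone (Gl I) C G L p"
  shows "matching_family C I G L (\<lambda>i. p (gl1 I i))"
proof -
  have "p (gl1 I i) \<in> Hom C L (omap G (gl1 I i))" if "i \<in> I" for i
    using assms that by (simp add: is_cone_def gl_in_obj)
  then show ?thesis
    by (simp add: matching_family_def cone_natural[OF assms] singleton_to_pair)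
qed

text \<open>Both composites factor through the common composite \<open>L \<rightarrow> G [i,j]\<close>, followed by the image of
  \<open>[i,j] \<rightarrow> a\<close>.\<close>

lemma leg_independent:
  assumes x: "matching_family C I G L x" and ij: "i \<in> I" "j \<in> I"
    and a: "(gl1 I i, a) \<in> gl_arr I" "(gl1 I j, a) \<in> gl_arr I"
  shows "amap G (gl1 I i, a) \<cdot>\<^bsub>C\<^esub> x i = amap G (gl1 I j, a) \<cdot>\<^bsub>C\<^esub> x j"
proof -
  have xi: "x i \<in> Hom C L (omap G (gl1 I i))" and xj: "x j \<in> Hom C L (omap G (gl1 I j))"
    and eq: "amap G (gl1 I i, gl2 I i j) \<cdot>\<^bsub>C\<^esub> x i = amap G (gl1 I j, gl2 I i j) \<cdot>\<^bsub>C\<^esub> x j"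
    using x ij by (auto simp: matching_family_def)
  have p: "(gl2 I i j, a) \<in> gl_arr I" by (rule pair_below[OF ij a])
  show ?thesis
    using amap_trans[OF singleton_to_pair(1)[OF ij] p xi]
      amap_trans[OF singleton_to_pair(2)[OF ij] p xj] eq
    by simp
qed

lemma matching_extends:
  assumes L: "L \<in> Obj C" and x: "matching_family C I G L x"
  obtains p where "is_cone (Gl I) C G L p" "\<forall>i\<in>I. p (gl1 I i) = x i"
proof -
  define s where "s a = (SOME i. i \<in> I \<and> (gl1 I i, a) \<in> gl_arr I)" for a
  define p where "p a = amap G (gl1 I (s a), a) \<cdot>\<^bsub>C\<^esub> x (s a)" for a
  have s: "s a \<in> I \<and> (gl1 I (s a), a) \<in> gl_arr I" if "a \<in> gl_obj I" for a
    unfolding s_def by (rule someI_ex) (metis that singleton_below)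
  have xi: "x i \<in> Hom C L (omap G (gl1 I i))" if "i \<in> I" for i
    using x that by (simp add: matching_family_def)
  have leg: "p a = amap G (gl1 I i, a) \<cdot>\<^bsub>C\<^esub> x i" if "i \<in> I" "(gl1 I i, a) \<in> gl_arr I" for a i
  proof -
    have "a \<in> gl_obj I" using gl_arr_obj[OF that(2)] by simp
    then show ?thesis
      unfolding p_def using leg_independent[OF x] s that by blast
  qed
  have "is_cone (Gl I) C G L p"
    unfolding is_cone_def
  proof (intro conjI ballI)
    fix a assume "a \<in> Obj (Gl I)"
    then show "p a \<in> Hom C L (omap G a)"
      unfolding p_def using s xi amap_pair C.Comp_in by simp blast
  next
    fix a b f assume "a \<in> Obj (Gl I)" "b \<in> Obj (Gl I)" "f \<in> Hom (Gl I) a b"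
    then have a: "a \<in> gl_obj I" and f: "f = (a, b)" "(a, b) \<in> gl_arr I"
      by (auto simp: Hom_def)
    have "amap G f \<cdot>\<^bsub>C\<^esub> p a = amap G (gl1 I (s a), b) \<cdot>\<^bsub>C\<^esub> x (s a)"
      unfolding p_def f(1) using s[OF a] f(2) xi by (auto intro: amap_trans)
    also have "\<dots> = p b"
      using leg s[OF a] gl_arr.comp[OF _ f(2)] by metis
    finally show "amap G f \<cdot>\<^bsub>C\<^esub> p a = p b" .
  qed (rule L)
  moreover have "p (gl1 I i) = x i" if "i \<in> I" for i
    using leg[OF that gl_arr.ident] amap_self[OF _ xi[OF that]] that by (simp add: gl_in_obj)
  ultimately show thesis using that by blast
qed

text \<open>All other legs are composites of those at the singletons.\<close>

lemma cone_morphism_on_singletons: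
  assumes p: "is_cone (Gl I) C G L p" and q: "is_cone (Gl I) C G M q"
  shows "cone_morphism (Gl I) C L p M q m \<longleftrightarrow>
    m \<in> Hom C L M \<and> (\<forall>i\<in>I. q (gl1 I i) \<cdot>\<^bsub>C\<^esub> m = p (gl1 I i))"
proof -
  have "q a \<cdot>\<^bsub>C\<^esub> m = p a"
    if m: "m \<in> Hom C L M" "\<forall>i\<in>I. q (gl1 I i) \<cdot>\<^bsub>C\<^esub> m = p (gl1 I i)" and a: "a \<in> gl_obj I" for a
  proof -
    obtain i where i: "i \<in> I" "(gl1 I i, a) \<in> gl_arr I" using a by (rule singleton_below)
    have "q (gl1 I i) \<in> Hom C M (omap G (gl1 I i))"
      using q i(1) by (simp add: is_cone_def gl_in_obj)
    then show ?thesis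
      using C.Comp_assoc[OF m(1) _ amap_pair[OF i(2)]] m(2) i
        cone_natural[OF p i(2)] cone_natural[OF q i(2)]
      by metis
  qed
  then show ?thesis by (auto simp: cone_morphism_def gl_in_obj)
qed

theorem limit_iff_generalized_pullback:
  assumes cone: "is_cone (Gl I) C G L p"
  shows "is_limit (Gl I) C G L p \<longleftrightarrow>
    is_generalized_pullback C I (\<lambda>i. omap G (gl1 I i)) (\<lambda>i j. amap G (eta1 I i j))
      (\<lambda>i j. amap G (tau2 I i j \<cdot>\<^bsub>Gl I\<^esub> eta1 I j i)) L (\<lambda>i. p (gl1 I i))"
proof -
  let ?med = "\<lambda>L' x' m. m \<in> Hom C L' L \<and> (\<forall>i\<in>I. p (gl1 I i) \<cdot>\<^bsub>C\<^esub> m = x' i)"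
  have "(\<forall>L' p'. is_cone (Gl I) C G L' p' \<longrightarrow> (\<exists>!m. cone_morphism (Gl I) C L' p' L p m)) \<longleftrightarrow>
    (\<forall>L'\<in>Obj C. \<forall>x'. matching_family C I G L' x' \<longrightarrow> (\<exists>!m. ?med L' x' m))"
    (is "?cones \<longleftrightarrow> ?families")
  proof (intro iffI ballI allI impI)
    fix L' x' assume univ: ?cones and L': "L' \<in> Obj C" and x': "matching_family C I G L' x'"
    obtain p' where p': "is_cone (Gl I) C G L' p'" "\<forall>i\<in>I. p' (gl1 I i) = x' i"
      using L' x' by (rule matching_extends)
    have "\<exists>!m. cone_morphism (Gl I) C L' p' L p m" using univ p'(1) by blast
    then show "\<exists>!m. ?med L' x' m"
      unfolding cone_morphism_on_singletons[OF p'(1) cone] using p'(2) by simp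
  next
    fix L' p' assume univ: ?families and p': "is_cone (Gl I) C G L' p'"
    have "L' \<in> Obj C" using p' by (simp add: is_cone_def)
    then have "\<exists>!m. ?med L' (\<lambda>i. p' (gl1 I i)) m"
      using univ cone_matching[OF p'] by blast
    then show "\<exists>!m. cone_morphism (Gl I) C L' p' L p m"
      unfolding cone_morphism_on_singletons[OF p' cone] .
  qed
  then show ?thesis
    using cone cone_matching[OF cone]
    unfolding is_limit_def generalized_pullback_iff_matching by (auto simp: is_cone_def)
qed

text \<open>The cone extending the legs at the singletons satisfies the same two equations, so it
  coincides with \<open>p\<close> on all \<open>[i,j,k]\<close>, and these exhaust the objects, because \<open>[i,j] = [i,j,j]\<close>
  and \<open>[i] = [i,i]\<close>.\<close>

lemma cone_if_determined_by_singletons: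
  assumes L: "L \<in> Obj C" and match: "matching_family C I G L (\<lambda>i. p (gl1 I i))"
    and pairs: "\<And>i j. i \<in> I \<Longrightarrow> j \<in> I \<Longrightarrow> p (gl2 I i j) = amap G (eta1 I i j) \<cdot>\<^bsub>C\<^esub> p (gl1 I i)"
    and triples: "\<And>i j k. i \<in> I \<Longrightarrow> j \<in> I \<Longrightarrow> k \<in> I \<Longrightarrow>
      p (gl3 I i j k) = amap G (eta2 I j i j k) \<cdot>\<^bsub>C\<^esub> p (gl2 I i j)"
  shows "is_cone (Gl I) C G L p"
proof -
  obtain q where q: "is_cone (Gl I) C G L q" "\<forall>i\<in>I. q (gl1 I i) = p (gl1 I i)"
    using L match by (rule matching_extends)
  have "p a = q a" if obj: "a \<in> gl_obj I" for a
  proof -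
    obtain i j k where ijk: "i \<in> I" "j \<in> I" "k \<in> I" and a: "a = gl3 I i j k"
      using obj by (rule gl_obj_gl3)
    have "q (gl2 I i j) = amap G (eta1 I i j) \<cdot>\<^bsub>C\<^esub> q (gl1 I i)"
      using cone_natural[OF q(1)] gl_arr.eta1[OF ijk(1,2)] by (simp add: eta1_def)
    then have "q (gl2 I i j) = p (gl2 I i j)" using q(2) pairs ijk by simp
    moreover have "q (gl3 I i j k) = amap G (eta2 I j i j k) \<cdot>\<^bsub>C\<^esub> q (gl2 I i j)"
      using cone_natural[OF q(1)] gl_arr.eta2[OF ijk, of j] by (simp add: eta2_def)
    ultimately show ?thesis using triples ijk a by simp
  qed
  then show ?thesis using q(1) by (auto simp: is_cone_def)
qed

end

section \<open>Characterization of glued-up objects\<close>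

theorem theorem1p7:
  fixes C :: "('o, 'a) cat" and I :: "'i set"
    and G :: "('i gl_word set, 'i gl_arrow, 'o, 'a) func"
    and L :: 'o and \<pi> :: "'i gl_word set \<Rightarrow> 'a"
  assumes "gluing_data_functor C I G"
    and "L \<in> Obj C"
    and "\<forall>a\<in>Obj (Gl I). \<pi> a \<in> Hom C L (omap G a)"
  shows "glued_up C I G L \<pi> \<longleftrightarrow>
    (\<forall>i\<in>I. \<forall>j\<in>I. \<pi> (gl2 I i j) = amap G (eta1 I i j) \<cdot>\<^bsub>C\<^esub> \<pi> (gl1 I i)) \<and>
    (\<forall>i\<in>I. \<forall>j\<in>I. \<forall>k\<in>I. \<forall>n\<in>{j, k}.
       \<pi> (gl3 I i j k) = amap G (eta2 I n i j k) \<cdot>\<^bsub>C\<^esub> \<pi> (gl2 I i n)) \<and>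
    is_generalized_pullback C I
      (\<lambda>i. omap G (gl1 I i))
      (\<lambda>i j. amap G (eta1 I i j))
      (\<lambda>i j. amap G (tau2 I i j \<cdot>\<^bsub>Gl I\<^esub> eta1 I j i))
      L (\<lambda>i. \<pi> (gl1 I i))"
proof -
  interpret gluing_data_functor C I G by fact
  interpret gl_diagram C I G by unfold_locales
  let ?pairs = "\<forall>i\<in>I. \<forall>j\<in>I. \<pi> (gl2 I i j) = amap G (eta1 I i j) \<cdot>\<^bsub>C\<^esub> \<pi> (gl1 I i)"
  let ?triples = "\<forall>i\<in>I. \<forall>j\<in>I. \<forall>k\<in>I. \<forall>n\<in>{j, k}.
    \<pi> (gl3 I i j k) = amap G (eta2 I n i j k) \<cdot>\<^bsub>C\<^esub> \<pi> (gl2 I i n)"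
  let ?pullback = "is_generalized_pullback C I (\<lambda>i. omap G (gl1 I i)) (\<lambda>i j. amap G (eta1 I i j))
      (\<lambda>i j. amap G (tau2 I i j \<cdot>\<^bsub>Gl I\<^esub> eta1 I j i)) L (\<lambda>i. \<pi> (gl1 I i))"
  have "glued_up C I G L \<pi> \<longleftrightarrow> is_limit (Gl I) C G L \<pi>"
    by (rule glued_up_iff_limit) (rule C.category_axioms)
  also have "\<dots> \<longleftrightarrow> ?pairs \<and> ?triples \<and> ?pullback"
  proof
    assume lim: "is_limit (Gl I) C G L \<pi>"
    then have cone: "is_cone (Gl I) C G L \<pi>" by (simp add: is_limit_def)
    have ?pairs
      using cone_natural[OF cone] gl_arr.eta1[of _ I] by (simp add: eta1_def)
    moreover have ?triples
      using cone_natural[OF cone] gl_arr.eta2[of _ I] by (auto simp: eta2_def)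
    ultimately show "?pairs \<and> ?triples \<and> ?pullback"
      using lim limit_iff_generalized_pullback[OF cone] by blast
  next
    assume h: "?pairs \<and> ?triples \<and> ?pullback"
    then have "matching_family C I G L (\<lambda>i. \<pi> (gl1 I i))"
      unfolding generalized_pullback_iff_matching by blast
    then have "is_cone (Gl I) C G L \<pi>"
      using cone_if_determined_by_singletons[of L \<pi>] assms(2) h by blast
    then show "is_limit (Gl I) C G L \<pi>"
      using h limit_iff_generalized_pullback by blast
  qed
  finally show ?thesis .
qed

end
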